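(* Let $\mathcal{H}$ be a separable complex Hilbert space and let $T \in B(\mathcal{H})$ be a partial isometry. Let $\mathcal{H}_1 = (\ker T)^{\perp}$ be the initial space of $T$, and let $A \in B(\mathcal{H}_1)$ be the compression of $T$ to $\mathcal{H}_1$, i.e. $A = P T|_{\mathcal{H}_1}$, where $P$ is the orthogonal projection of $\mathcal{H}$ onto $\mathcal{H}_1$. Then $T$ is a complex symmetric operator on $\mathcal{H}$ if and only if $A$ is a complex symmetric operator on $\mathcal{H}_1$.
   Context: $B(\mathcal{H})$ denotes the bounded linear operators on $\mathcal{H}$. A conjugation on a complex Hilbert space $\mathcal{H}$ is a conjugate-linear operator $C:\mathcal{H}\to\mathcal{H}$ which is involutive ($C^2 = I$) and isometric ($\langle Cx, Cy\rangle = \langle y, x\rangle$ for all $x,y \in \mathcal{H}$). An operator $T \in B(\mathcal{H})$ is $C$-symmetric if $T = CT^*C$, and $T$ is complex symmetric if there exists a conjugation $C$ on $\mathcal{H}$ with respect to which $T$ is $C$-symmetric. *)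

theory Defs
  imports "HOL-Analysis.Analysis"
begin

text \<open>Complex inner product spaces; \<open>cinner\<close> is linear in its first argument and
  conjugate-linear in its second. The metric structure is inherited from
  \<^class>\<open>real_normed_vector\<close>, and the last axiom says that the norm is the one
  induced by \<open>cinner\<close>.\<close>

class complex_inner = real_normed_vector +
  fixes scaleC :: "complex \<Rightarrow> 'a \<Rightarrow> 'a"  (infixr "*\<^sub>C" 75)
    and cinner :: "'a \<Rightarrow> 'a \<Rightarrow> complex"
  assumes scaleC_add_right: "a *\<^sub>C (x + y) = a *\<^sub>C x + a *\<^sub>C y"
    and scaleC_add_left: "(a + b) *\<^sub>C x = a *\<^sub>C x + b *\<^sub>C x"
    and scaleC_scaleC: "a *\<^sub>C (b *\<^sub>C x) = (a * b) *\<^sub>C x"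
    and scaleC_one: "1 *\<^sub>C x = x"
    and scaleC_of_real: "complex_of_real r *\<^sub>C x = r *\<^sub>R x"
    and cinner_commute: "cinner x y = cnj (cinner y x)"
    and cinner_add_left: "cinner (x + y) z = cinner x z + cinner y z"
    and cinner_scaleC_left: "cinner (a *\<^sub>C x) y = a * cinner x y"
    and cinner_self: "cinner x x = complex_of_real ((norm x)\<^sup>2)"

class complex_hilbert_space = complex_inner + complete_space

instantiation complex :: complex_hilbert_space
begin

definition scaleC_complex :: "complex \<Rightarrow> complex \<Rightarrow> complex"
  where "scaleC_complex a x = a * x"

definition cinner_complex :: "complex \<Rightarrow> complex \<Rightarrow> complex"
  where "cinner_complex x y = x * cnj y"

instance
  by standard
    (simp_all add: scaleC_complex_def cinner_complex_def algebra_simps scaleR_conv_of_real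
      complex_norm_square[symmetric])

end

definition orthogonal_complement :: "'a::complex_inner set \<Rightarrow> 'a set"
  where "orthogonal_complement S = {x. \<forall>y\<in>S. cinner x y = 0}"

definition kernel :: "('a::complex_inner \<Rightarrow> 'a) \<Rightarrow> 'a set"
  where "kernel T = {x. T x = 0}"

text \<open>A closed subspace \<open>M\<close> of a Hilbert space is itself a Hilbert space with the inherited
  inner product. Operators on \<open>M\<close> are represented by functions on the ambient type, of which
  only the values on \<open>M\<close> matter; the definitions below are meant for closed subspaces \<open>M\<close>, and
  \<open>M = UNIV\<close> gives the corresponding notions on the whole space.\<close>

definition orth_proj :: "'a::complex_inner set \<Rightarrow> 'a \<Rightarrow> 'a"
  where "orth_proj M x = (THE p. p \<in> M \<and> x - p \<in> orthogonal_complement M)"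

definition bounded_op_on :: "'a::complex_inner set \<Rightarrow> ('a \<Rightarrow> 'a) \<Rightarrow> bool"
  where "bounded_op_on M T \<longleftrightarrow>
    T ` M \<subseteq> M \<and>
    (\<forall>x\<in>M. \<forall>y\<in>M. T (x + y) = T x + T y) \<and>
    (\<forall>a. \<forall>x\<in>M. T (a *\<^sub>C x) = a *\<^sub>C T x) \<and>
    (\<exists>K. \<forall>x\<in>M. norm (T x) \<le> K * norm x)"

lemma bounded_op_on_UNIV_iff:
  "bounded_op_on UNIV T \<longleftrightarrow> bounded_linear T \<and> (\<forall>a x. T (a *\<^sub>C x) = a *\<^sub>C T x)"
proof
  assume T: "bounded_op_on UNIV T"
  then obtain K where K: "norm (T x) \<le> K * norm x" for x
    by (auto simp: bounded_op_on_def)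
  have "T (r *\<^sub>R x) = r *\<^sub>R T x" for r x
    using T by (simp add: bounded_op_on_def flip: scaleC_of_real)
  then have "bounded_linear T"
    using T K by (intro bounded_linear_intro[where K = K])
      (auto simp: bounded_op_on_def mult.commute)
  with T show "bounded_linear T \<and> (\<forall>a x. T (a *\<^sub>C x) = a *\<^sub>C T x)"
    by (simp add: bounded_op_on_def)
next
  assume T: "bounded_linear T \<and> (\<forall>a x. T (a *\<^sub>C x) = a *\<^sub>C T x)"
  then obtain K where "\<forall>x. norm (T x) \<le> norm x * K"
    using bounded_linear.bounded by blast
  with T show "bounded_op_on UNIV T"
    by (auto simp: bounded_op_on_def linear_add bounded_linear.linear mult.commute)
qed

definition adjoint_on :: "'a::complex_inner set \<Rightarrow> ('a \<Rightarrow> 'a) \<Rightarrow> 'a \<Rightarrow> 'a"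
  where "adjoint_on M T y = (THE z. z \<in> M \<and> (\<forall>x\<in>M. cinner (T x) y = cinner x z))"

definition conjugation_on :: "'a::complex_inner set \<Rightarrow> ('a \<Rightarrow> 'a) \<Rightarrow> bool"
  where "conjugation_on M C \<longleftrightarrow>
    C ` M \<subseteq> M \<and>
    (\<forall>x\<in>M. \<forall>y\<in>M. C (x + y) = C x + C y) \<and>
    (\<forall>a. \<forall>x\<in>M. C (a *\<^sub>C x) = cnj a *\<^sub>C C x) \<and>
    (\<forall>x\<in>M. C (C x) = x) \<and>
    (\<forall>x\<in>M. \<forall>y\<in>M. cinner (C x) (C y) = cinner y x)"

definition C_symmetric_on :: "'a::complex_inner set \<Rightarrow> ('a \<Rightarrow> 'a) \<Rightarrow> ('a \<Rightarrow> 'a) \<Rightarrow> bool"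
  where "C_symmetric_on M C T \<longleftrightarrow>
    bounded_op_on M T \<and> (\<forall>x\<in>M. T x = C (adjoint_on M T (C x)))"

definition complex_symmetric_on :: "'a::complex_inner set \<Rightarrow> ('a \<Rightarrow> 'a) \<Rightarrow> bool"
  where "complex_symmetric_on M T \<longleftrightarrow> (\<exists>C. conjugation_on M C \<and> C_symmetric_on M C T)"

definition initial_space :: "('a::complex_inner \<Rightarrow> 'a) \<Rightarrow> 'a set"
  where "initial_space T = orthogonal_complement (kernel T)"

definition partial_isometry :: "('a::complex_inner \<Rightarrow> 'a) \<Rightarrow> bool"
  where "partial_isometry T \<longleftrightarrow>
    bounded_op_on UNIV T \<and> (\<forall>x\<in>initial_space T. norm (T x) = norm x)"

end

theory Submission
  imports Defs
begin

text \<open>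
  The proof rests on replacing the equation \<open>T = C T* C\<close> by the symmetry of a bilinear form:
  \<open>T\<close> is \<open>C\<close>-symmetric iff \<open>\<langle>T x, C y\<rangle> = \<langle>T y, C x\<rangle>\<close> for all \<open>x\<close> and \<open>y\<close>
  (\<open>C_symmetric_on_iff\<close>). In this form the adjoint disappears; the Riesz representation theorem
  is used once, to make sure that the adjoint behind the definition exists.

  If \<open>T\<close> is \<open>C\<close>-symmetric, then \<open>J = C T\<close> maps the initial space \<open>H\<^sub>1\<close> into itself, because
  \<open>\<langle>k, C T x\<rangle> = \<langle>T k, C x\<rangle> = 0\<close> for \<open>k\<close> in the kernel. It is isometric on \<open>H\<^sub>1\<close> since \<open>T\<close> is, and
  \<open>\<langle>J J x, y\<rangle> = \<langle>T x, T y\<rangle> = \<langle>x, y\<rangle>\<close> shows that it is an involution there. So \<open>J\<close> is a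
  conjugation on \<open>H\<^sub>1\<close>. Finally \<open>\<langle>A x, J y\<rangle> = \<langle>T x, C T y\<rangle>\<close>, which is symmetric in \<open>x\<close> and \<open>y\<close>
  for every conjugation \<open>C\<close>.

  Conversely, let \<open>A\<close> be \<open>J\<close>-symmetric. A conjugation \<open>C\<close> of the whole space with \<open>C T = J\<close> on
  \<open>H\<^sub>1\<close> makes \<open>T\<close> symmetric, because \<open>\<langle>T x, C y\<rangle>\<close> is then \<open>\<langle>y\<^sub>1, J x\<^sub>1\<rangle>\<close>, where the index denotes
  the component in \<open>H\<^sub>1\<close>. Such a \<open>C\<close> has to exchange \<open>T x\<close> and \<open>J x\<close> for all \<open>x\<close> in \<open>H\<^sub>1\<close>.
  This prescription is compatible with the inner product exactly because \<open>T\<close> and \<open>J\<close> are isometric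
  on \<open>H\<^sub>1\<close> and \<open>\<langle>T x, J y\<rangle> = \<langle>A x, J y\<rangle>\<close> is symmetric. By Zorn's lemma every compatible
  prescription extends to a conjugation (\<open>conj_rel_extends\<close>).
\<close>

section \<open>Complex inner product spaces\<close>

lemma scaleC_zero_left [simp]: "0 *\<^sub>C (x::'a::complex_inner) = 0"
  using scaleC_of_real[of 0 x] by simp

lemma scaleC_minus_one: "(-1) *\<^sub>C (x::'a::complex_inner) = - x"
  using scaleC_of_real[of "-1" x] by simp

lemma cinner_eq_commute: "cinner x y = cinner u v \<Longrightarrow> cinner y x = cinner v (u::'a::complex_inner)"
  using cinner_commute[of y x] cinner_commute[of v u] by simp

lemma cinner_eq_0_commute: "cinner x y = 0 \<Longrightarrow> cinner y (x::'a::complex_inner) = 0"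
  using cinner_commute[of y x] by simp

lemma cinner_add_right: "cinner (x::'a::complex_inner) (y + z) = cinner x y + cinner x z"
  using cinner_commute[of x "y + z"] cinner_commute[of x y] cinner_commute[of x z]
  by (simp add: cinner_add_left)

lemma cinner_scaleC_right: "cinner (x::'a::complex_inner) (a *\<^sub>C y) = cnj a * cinner x y"
  using cinner_commute[of x "a *\<^sub>C y"] cinner_commute[of x y] by (simp add: cinner_scaleC_left)

lemma cinner_zero_left [simp]: "cinner (0::'a::complex_inner) y = 0"
  using cinner_add_left[of 0 0 y] by simp

lemma cinner_zero_right [simp]: "cinner (x::'a::complex_inner) 0 = 0"
  using cinner_add_right[of x 0 0] by simp

lemma cinner_diff_left: "cinner (x - y) (z::'a::complex_inner) = cinner x z - cinner y z"
  using cinner_add_left[of "x - y" y z] by simp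

lemma cinner_diff_right: "cinner (x::'a::complex_inner) (y - z) = cinner x y - cinner x z"
  using cinner_add_right[of x "y - z" z] by simp

lemma cinner_self_eq_0_iff [simp]: "cinner x x = 0 \<longleftrightarrow> (x::'a::complex_inner) = 0"
  by (simp add: cinner_self)

lemma cinner_self_eq_iff: "cinner x x = cinner y y \<longleftrightarrow> norm (x::'a::complex_inner) = norm y"
  unfolding cinner_self of_real_eq_iff by simp

lemma norm_add_square:
  "(norm (x + y :: 'a::complex_inner))\<^sup>2 = (norm x)\<^sup>2 + (norm y)\<^sup>2 + 2 * Re (cinner x y)"
proof -
  have "complex_of_real ((norm (x + y))\<^sup>2) = cinner x x + cinner y y + (cinner x y + cinner y x)"
    by (simp only: cinner_self[symmetric] cinner_add_left cinner_add_right add_ac)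
  also have "cinner x y + cinner y x = complex_of_real (2 * Re (cinner x y))"
    using cinner_commute[of y x] by (simp add: complex_add_cnj)
  also have "cinner x x + cinner y y + complex_of_real (2 * Re (cinner x y)) =
      complex_of_real ((norm x)\<^sup>2 + (norm y)\<^sup>2 + 2 * Re (cinner x y))"
    by (simp add: cinner_self)
  finally show ?thesis
    by (simp only: of_real_eq_iff)
qed

lemma parallelogram_law:
  "(norm (x + y :: 'a::complex_inner))\<^sup>2 + (norm (x - y))\<^sup>2 = 2 * (norm x)\<^sup>2 + 2 * (norm y)\<^sup>2"
  using norm_add_square[of x y] norm_add_square[of x "-y"] cinner_diff_right[of x 0 y] by simp

text \<open>This is the distance from \<open>x\<close> to its component along \<open>y\<close>; it yields the Cauchy-Schwarz
  inequality as well as the orthogonality of the error of a best approximation.\<close>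

lemma norm_remove_component_square:
  fixes x y :: "'a::complex_inner"
  assumes "y \<noteq> 0"
  shows "(norm (x - (cinner x y / (norm y)\<^sup>2) *\<^sub>C y))\<^sup>2 = (norm x)\<^sup>2 - (cmod (cinner x y))\<^sup>2 / (norm y)\<^sup>2"
proof -
  define c where "c = cinner x y / (norm y)\<^sup>2"
  have y: "cinner y y = (norm y)\<^sup>2" "complex_of_real ((norm y)\<^sup>2) \<noteq> 0"
    using assms by (simp_all add: cinner_self)
  have orth: "cinner (x - c *\<^sub>C y) y = 0"
    using y by (simp add: cinner_diff_left cinner_scaleC_left c_def)
  have "complex_of_real ((norm (x - c *\<^sub>C y))\<^sup>2) = cinner (x - c *\<^sub>C y) x"
    by (simp only: cinner_self[symmetric] cinner_diff_right[of "x - c *\<^sub>C y" x] cinner_scaleC_right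
        orth mult_zero_right diff_zero)
  also have "\<dots> = (norm x)\<^sup>2 - c * cnj (cinner x y)"
    using cinner_commute[of y x] by (simp add: cinner_diff_left cinner_scaleC_left cinner_self)
  also have "c * cnj (cinner x y) = (cmod (cinner x y))\<^sup>2 / (norm y)\<^sup>2"
    by (simp only: c_def times_divide_eq_left complex_norm_square of_real_divide)
  finally have "complex_of_real ((norm (x - c *\<^sub>C y))\<^sup>2) =
      complex_of_real ((norm x)\<^sup>2 - (cmod (cinner x y))\<^sup>2 / (norm y)\<^sup>2)"
    by (simp only: of_real_diff of_real_divide)
  then show ?thesis
    unfolding c_def of_real_eq_iff .
qed

lemma cauchy_schwarz: "cmod (cinner x y) \<le> norm (x::'a::complex_inner) * norm y"
proof (cases "y = 0")
  case False
  then have "0 \<le> (norm x)\<^sup>2 - (cmod (cinner x y))\<^sup>2 / (norm y)\<^sup>2"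
    using norm_remove_component_square[of y x] by (metis zero_le_power2)
  then have "(cmod (cinner x y))\<^sup>2 \<le> (norm x * norm y)\<^sup>2"
    using False by (simp add: field_simps)
  then show ?thesis
    by (rule power2_le_imp_le) simp
qed simp

lemma bounded_bilinear_cinner:
  "bounded_bilinear (cinner :: 'a::complex_inner \<Rightarrow> 'a \<Rightarrow> complex)"
proof
  show "\<exists>K. \<forall>a b :: 'a. cmod (cinner a b) \<le> norm a * norm b * K"
    by (rule exI[of _ 1]) (simp add: cauchy_schwarz)
qed (simp_all add: cinner_add_left cinner_add_right cinner_scaleC_left cinner_scaleC_right
      scaleR_conv_of_real flip: scaleC_of_real)

lemmas tendsto_cinner [tendsto_intros] = bounded_bilinear.tendsto[OF bounded_bilinear_cinner]

section \<open>Closed subspaces, orthogonal projections and functionals\<close>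

definition closed_subspace :: "'a::complex_inner set \<Rightarrow> bool"
  where "closed_subspace M \<longleftrightarrow> closed M \<and> 0 \<in> M \<and> (\<forall>x\<in>M. \<forall>y\<in>M. x + y \<in> M) \<and>
    (\<forall>a. \<forall>x\<in>M. a *\<^sub>C x \<in> M)"

lemma closed_subspace_diff: "x - y \<in> M" if "closed_subspace M" "x \<in> M" "y \<in> M"
proof -
  have "x + (-1) *\<^sub>C y \<in> M"
    using that unfolding closed_subspace_def by blast
  then show ?thesis
    by (simp add: scaleC_minus_one)
qed

lemma closed_subspace_UNIV: "closed_subspace UNIV"
  by (simp add: closed_subspace_def)

lemma closed_subspace_orthogonal_complement: "closed_subspace (orthogonal_complement S)"
proof -
  have "closed (orthogonal_complement S)"
  proof (rule closed_sequential_limits[THEN iffD2, rule_format])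
    fix x l assume x: "(\<forall>n. x n \<in> orthogonal_complement S) \<and> x \<longlonglongrightarrow> l"
    show "l \<in> orthogonal_complement S"
      unfolding orthogonal_complement_def
    proof safe
      fix y assume "y \<in> S"
      then have "(\<lambda>n. cinner (x n) y) = (\<lambda>n. 0)"
        using x by (auto simp: orthogonal_complement_def)
      moreover have "(\<lambda>n. cinner (x n) y) \<longlonglongrightarrow> cinner l y"
        using x by (auto intro!: tendsto_intros)
      ultimately show "cinner l y = 0"
        by (simp add: LIMSEQ_const_iff)
    qed
  qed
  then show ?thesis
    by (auto simp: closed_subspace_def orthogonal_complement_def cinner_add_left cinner_scaleC_left)
qed

text \<open>The values of \<open>f\<close> are vectors so that the lemma serves the kernel of an operator as well as,
  with scalars as a one-dimensional space, the kernel of a functional.\<close>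

lemma closed_subspace_functional_kernel:
  fixes f :: "'a::complex_inner \<Rightarrow> 'b::complex_inner"
  assumes M: "closed_subspace M"
    and add: "\<And>x y. x \<in> M \<Longrightarrow> y \<in> M \<Longrightarrow> f (x + y) = f x + f y"
    and scale: "\<And>a x. x \<in> M \<Longrightarrow> f (a *\<^sub>C x) = a *\<^sub>C f x"
    and bound: "\<And>x. x \<in> M \<Longrightarrow> norm (f x) \<le> K * norm x"
  shows "closed_subspace {x\<in>M. f x = 0}"
proof -
  have M': "0 \<in> M" "closed M"
    using M by (auto simp: closed_subspace_def)
  have f0: "f 0 = 0"
    using add[of 0 0] M' by simp
  have a0: "a *\<^sub>C (0::'b) = 0" for a
    using cinner_scaleC_left[of a 0 "a *\<^sub>C (0::'b)"] cinner_self_eq_0_iff[of "a *\<^sub>C (0::'b)"] by simp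
  have "closed {x\<in>M. f x = 0}"
  proof (rule closed_sequential_limits[THEN iffD2, rule_format])
    fix x l assume x: "(\<forall>n. x n \<in> {x\<in>M. f x = 0}) \<and> x \<longlonglongrightarrow> l"
    then have l: "l \<in> M"
      using M' closed_sequentially by blast
    have le: "norm (f l) \<le> K * norm (l - x n)" for n
    proof -
      have "l - x n \<in> M"
        using closed_subspace_diff[OF M l] x by simp
      then have "f l = f (l - x n) + f (x n)"
        using add[of "l - x n" "x n"] x by simp
      then show ?thesis
        using bound[OF \<open>l - x n \<in> M\<close>] x by simp
    qed
    have "(\<lambda>n. K * norm (l - x n)) \<longlonglongrightarrow> K * norm (l - l)"
      using x by (intro tendsto_intros) auto
    then have "norm (f l) \<le> K * norm (l - l)"
      using le by (intro LIMSEQ_le_const) auto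
    with l show "l \<in> {x\<in>M. f x = 0}" by simp
  qed
  then show ?thesis
    using M f0 by (auto simp: closed_subspace_def add scale a0)
qed

lemma best_approximation_exists:
  fixes x :: "'a::complex_hilbert_space"
  assumes M: "closed_subspace M"
  obtains p where "p \<in> M" "\<And>y. y \<in> M \<Longrightarrow> norm (x - p) \<le> norm (x - y)"
proof -
  define d where "d = infdist x M"
  have M': "M \<noteq> {}" "closed M"
    using M by (auto simp: closed_subspace_def)
  have d: "0 \<le> d" and d_le: "y \<in> M \<Longrightarrow> d \<le> norm (x - y)" for y
    unfolding d_def using infdist_nonneg infdist_le by (auto simp: dist_norm[symmetric])
  have "\<exists>y\<in>M. (norm (x - y))\<^sup>2 < d\<^sup>2 + inverse (real (Suc n))" for n
  proof -
    let ?e = "sqrt (d\<^sup>2 + inverse (real (Suc n)))"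
    have "d < ?e"
      by (rule real_less_rsqrt) simp
    then obtain y where "y \<in> M" "norm (x - y) < ?e"
      using cInf_lessD[of "dist x ` M" ?e] M'
      by (auto simp: d_def infdist_def dist_norm)
    then have "(norm (x - y))\<^sup>2 < ?e\<^sup>2"
      by (intro power_strict_mono) auto
    then show ?thesis
      using \<open>y \<in> M\<close> by (auto simp: add_nonneg_nonneg)
  qed
  then obtain y where y: "\<And>n. y n \<in> M"
    "\<And>n. (norm (x - y n))\<^sup>2 < d\<^sup>2 + inverse (real (Suc n))"
    by metis
  \<comment> \<open>The midpoint of \<open>y m\<close> and \<open>y n\<close> is not closer to \<open>x\<close> than \<open>d\<close>, so the parallelogram law
    forces two good approximations to be close to each other.\<close>
  have close: "(norm (y m - y n))\<^sup>2 \<le> 2 * inverse (real (Suc m)) + 2 * inverse (real (Suc n))" for m n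
  proof -
    have "(1/2::complex) *\<^sub>C (y m + y n) = (1/2::real) *\<^sub>R (y m + y n)"
      using scaleC_of_real[of "1/2" "y m + y n"] by simp
    moreover have "(1/2::complex) *\<^sub>C (y m + y n) \<in> M"
      using M y(1) by (auto simp: closed_subspace_def)
    ultimately have "d \<le> norm (x - (1/2::real) *\<^sub>R (y m + y n))"
      by (simp add: d_le)
    also have "x - (1/2::real) *\<^sub>R (y m + y n) = (1/2) *\<^sub>R ((x - y m) + (x - y n))"
      by (simp add: algebra_simps flip: scaleR_left.add)
    finally have "2 * d \<le> norm ((x - y m) + (x - y n))"
      by simp
    then have "(2 * d)\<^sup>2 \<le> (norm ((x - y m) + (x - y n)))\<^sup>2"
      using d by (intro power_mono) auto
    then show ?thesis
      using parallelogram_law[of "x - y m" "x - y n"] y(2)[of m] y(2)[of n]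
      by (simp add: norm_minus_commute power_mult_distrib)
  qed
  have "Cauchy y"
  proof (rule metric_CauchyI)
    fix e :: real assume "0 < e"
    then obtain N where N: "inverse (real (Suc N)) < e\<^sup>2 / 4"
      using reals_Archimedean[of "e\<^sup>2 / 4"] by auto
    have "dist (y m) (y n) < e" if "N \<le> m" "N \<le> n" for m n
    proof -
      have "inverse (real (Suc m)) \<le> inverse (real (Suc N))"
        "inverse (real (Suc n)) \<le> inverse (real (Suc N))"
        using that by (auto intro!: le_imp_inverse_le)
      then have "(norm (y m - y n))\<^sup>2 < e\<^sup>2"
        using close[of m n] N by linarith
      then show ?thesis
        using \<open>0 < e\<close> power2_less_imp_less[of "norm (y m - y n)" e] by (simp add: dist_norm)
    qed
    then show "\<exists>N. \<forall>m\<ge>N. \<forall>n\<ge>N. dist (y m) (y n) < e" by blast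
  qed
  then obtain p where p: "y \<longlonglongrightarrow> p"
    using Cauchy_convergent convergent_def by blast
  have "p \<in> M"
    using p y(1) M' closed_sequentially by blast
  moreover have "norm (x - p) \<le> d"
  proof -
    have "(\<lambda>n. (norm (x - y n))\<^sup>2) \<longlonglongrightarrow> (norm (x - p))\<^sup>2"
      using p by (intro tendsto_intros)
    moreover have "(\<lambda>n. d\<^sup>2 + inverse (real (Suc n))) \<longlonglongrightarrow> d\<^sup>2 + 0"
      by (intro tendsto_intros LIMSEQ_inverse_real_of_nat)
    ultimately have "(norm (x - p))\<^sup>2 \<le> d\<^sup>2 + 0"
      using y(2) by (intro LIMSEQ_le) (auto intro: less_imp_le)
    then show ?thesis
      by (simp add: abs_le_square_iff[symmetric] d)
  qed
  ultimately show thesis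
    using d_le by (intro that[of p]) (auto intro: order_trans)
qed

lemma orthogonal_decomposition:
  fixes x :: "'a::complex_hilbert_space"
  assumes M: "closed_subspace M"
  obtains p where "p \<in> M" "x - p \<in> orthogonal_complement M"
proof -
  obtain p where p: "p \<in> M" "\<And>y. y \<in> M \<Longrightarrow> norm (x - p) \<le> norm (x - y)"
    using best_approximation_exists[OF M] by blast
  have "cinner (x - p) y = 0" if y: "y \<in> M" for y
  proof (cases "y = 0")
    case False
    define c where "c = cinner (x - p) y / (norm y)\<^sup>2"
    have "p + c *\<^sub>C y \<in> M"
      using M p(1) y by (auto simp: closed_subspace_def)
    then have "(norm (x - p))\<^sup>2 \<le> (norm (x - p - c *\<^sub>C y))\<^sup>2"
      using p(2)[of "p + c *\<^sub>C y"] by (intro power_mono) (auto simp: diff_diff_eq)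
    also have "\<dots> = (norm (x - p))\<^sup>2 - (cmod (cinner (x - p) y))\<^sup>2 / (norm y)\<^sup>2"
      unfolding c_def by (rule norm_remove_component_square[OF False])
    finally show ?thesis
      using False by (simp add: field_simps)
  qed simp
  then show thesis
    using that[of p] p(1) by (auto simp: orthogonal_complement_def)
qed

lemma orth_proj_eqI:
  fixes x :: "'a::complex_inner"
  assumes M: "closed_subspace M" and p: "p \<in> M" "x - p \<in> orthogonal_complement M"
  shows "orth_proj M x = p"
  unfolding orth_proj_def
proof (rule the_equality)
  fix q assume q: "q \<in> M \<and> x - q \<in> orthogonal_complement M"
  have "q - p \<in> M"
    using closed_subspace_diff[OF M] p q by blast
  then have "cinner (x - p) (q - p) = 0" "cinner (x - q) (q - p) = 0"
    using p q by (auto simp: orthogonal_complement_def)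
  then have "cinner (q - p) (q - p) = 0"
    by (simp add: cinner_diff_left)
  then show "q = p" by simp
qed (use p in auto)

lemma
  fixes x :: "'a::complex_hilbert_space"
  assumes M: "closed_subspace M"
  shows orth_proj_in: "orth_proj M x \<in> M"
    and cinner_orth_proj: "y \<in> M \<Longrightarrow> cinner (orth_proj M x) y = cinner x y"
proof -
  obtain p where p: "p \<in> M" "x - p \<in> orthogonal_complement M"
    using orthogonal_decomposition[OF M] by blast
  have eq: "orth_proj M x = p"
    using orth_proj_eqI[OF M p] .
  show "orth_proj M x \<in> M"
    using p eq by simp
  show "cinner (orth_proj M x) y = cinner x y" if "y \<in> M"
    using p(2) that unfolding eq by (auto simp: orthogonal_complement_def cinner_diff_left)
qed

lemma cinner_ext_on:
  assumes M: "closed_subspace M" and "x \<in> M" "y \<in> M"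
    and eq: "\<And>z. z \<in> M \<Longrightarrow> cinner x z = cinner y z"
  shows "x = y"
proof -
  have "x - y \<in> M"
    using closed_subspace_diff[OF M] assms by blast
  then have "cinner (x - y) (x - y) = 0"
    using eq[of "x - y"] by (simp add: cinner_diff_left)
  then show ?thesis by simp
qed

text \<open>The kernel of a nonzero functional has codimension one in \<open>M\<close>, so a vector \<open>u\<close> of \<open>M\<close> orthogonal
  to it spans the complement. The multiple of \<open>u\<close> that represents \<open>f\<close> at \<open>u\<close> represents it
  everywhere.\<close>

lemma riesz_representation_on:
  fixes f :: "'a::complex_hilbert_space \<Rightarrow> complex"
  assumes M: "closed_subspace M"
    and add: "\<And>x y. x \<in> M \<Longrightarrow> y \<in> M \<Longrightarrow> f (x + y) = f x + f y"
    and scale: "\<And>a x. x \<in> M \<Longrightarrow> f (a *\<^sub>C x) = a * f x"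
    and bound: "\<And>x. x \<in> M \<Longrightarrow> norm (f x) \<le> K * norm x"
  obtains z where "z \<in> M" "\<And>x. x \<in> M \<Longrightarrow> f x = cinner x z"
proof (cases "\<forall>x\<in>M. f x = 0")
  case True
  then show thesis
    using that[of 0] M by (auto simp: closed_subspace_def)
next
  case False
  then obtain x0 where x0: "x0 \<in> M" "f x0 \<noteq> 0" by blast
  define N where "N = {x\<in>M. f x = 0}"
  have N: "closed_subspace N"
    unfolding N_def using scale
    by (intro closed_subspace_functional_kernel[OF M add _ bound]) (auto simp: scaleC_complex_def)
  obtain p where p: "p \<in> N" "x0 - p \<in> orthogonal_complement N"
    using orthogonal_decomposition[OF N] by blast
  define u where "u = x0 - p"
  have u: "u \<in> M"
    unfolding u_def using closed_subspace_diff[OF M] x0 p by (auto simp: N_def)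
  have fu: "f u \<noteq> 0"
    using add[OF u, of p] x0 p by (auto simp: u_def N_def)
  have u0: "u \<noteq> 0"
    using fu add[of 0 0] M by (auto simp: closed_subspace_def)
  have "f x = cinner x (cnj (f u / cinner u u) *\<^sub>C u)" if x: "x \<in> M" for x
  proof -
    define w where "w = x - (f x / f u) *\<^sub>C u"
    have m: "(f x / f u) *\<^sub>C u \<in> M"
      using M u by (auto simp: closed_subspace_def)
    have w: "w \<in> M"
      unfolding w_def by (rule closed_subspace_diff[OF M x m])
    have "f x = f w + f ((f x / f u) *\<^sub>C u)"
      using add[OF w m] by (simp add: w_def)
    then have "f w = 0"
      using scale[OF u] fu by simp
    then have "cinner u w = 0"
      using w p(2) by (auto simp: N_def u_def orthogonal_complement_def)
    then have "cinner w u = 0"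
      by (rule cinner_eq_0_commute)
    then have "cinner x u = f x / f u * cinner u u"
      by (simp add: w_def cinner_diff_left cinner_scaleC_left)
    then show ?thesis
      using fu u0 by (simp add: cinner_scaleC_right)
  qed
  moreover have "cnj (f u / cinner u u) *\<^sub>C u \<in> M"
    using M u unfolding closed_subspace_def by blast
  ultimately show thesis
    using that by blast
qed

section \<open>Complex symmetry as symmetry of a bilinear form\<close>

lemma adjoint_on_eqI:
  assumes M: "closed_subspace M" and z: "z \<in> M" "\<And>x. x \<in> M \<Longrightarrow> cinner (T x) y = cinner x z"
  shows "adjoint_on M T y = z"
  unfolding adjoint_on_def
proof (rule the_equality)
  fix w assume w: "w \<in> M \<and> (\<forall>x\<in>M. cinner (T x) y = cinner x w)"
  show "w = z"
  proof (rule cinner_ext_on[OF M])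
    fix x assume "x \<in> M"
    then have "cinner x w = cinner x z"
      using w z by auto
    then show "cinner w x = cinner z x"
      by (rule cinner_eq_commute)
  qed (use w z in auto)
qed (use z in auto)

lemma
  fixes T :: "'a::complex_hilbert_space \<Rightarrow> 'a"
  assumes M: "closed_subspace M" and T: "bounded_op_on M T"
  shows adjoint_on_in: "adjoint_on M T y \<in> M"
    and cinner_adjoint_on: "x \<in> M \<Longrightarrow> cinner (T x) y = cinner x (adjoint_on M T y)"
proof -
  obtain K where K: "\<And>x. x \<in> M \<Longrightarrow> norm (T x) \<le> K * norm x"
    using T unfolding bounded_op_on_def by blast
  have "cmod (cinner (T x) y) \<le> (K * norm y) * norm x" if "x \<in> M" for x
    using cauchy_schwarz[of "T x" y] mult_right_mono[OF K[OF that] norm_ge_zero[of y]]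
    by (simp add: mult_ac)
  then obtain z where z: "z \<in> M" "\<And>x. x \<in> M \<Longrightarrow> cinner (T x) y = cinner x z"
    using riesz_representation_on[OF M, of "\<lambda>x. cinner (T x) y" "K * norm y"] T
    by (auto simp: bounded_op_on_def cinner_add_left cinner_scaleC_left)
  have eq: "adjoint_on M T y = z"
    using adjoint_on_eqI[OF M z] .
  show "adjoint_on M T y \<in> M" "x \<in> M \<Longrightarrow> cinner (T x) y = cinner x (adjoint_on M T y)"
    using z eq by auto
qed

text \<open>For a conjugation \<open>C\<close>, the form \<open>(x, y) \<mapsto> \<langle>x, C y\<rangle>\<close> is symmetric.\<close>

lemma cinner_conjugation_swap:
  assumes "conjugation_on M C" "x \<in> M" "y \<in> M"
  shows "cinner x (C y) = cinner y (C x)"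
proof -
  have "C x \<in> M" "C (C x) = x"
    using assms by (auto simp: conjugation_on_def)
  moreover from this have "cinner (C (C x)) (C y) = cinner y (C x)"
    using assms unfolding conjugation_on_def by blast
  ultimately show ?thesis by simp
qed

text \<open>In the form \<open>\<langle>x, C y\<rangle>\<close> the transpose of \<open>T\<close> is \<open>C T* C\<close>, so \<open>C\<close>-symmetry says that \<open>T\<close>
  equals its transpose.\<close>

lemma C_symmetric_on_iff:
  fixes T :: "'a::complex_hilbert_space \<Rightarrow> 'a"
  assumes M: "closed_subspace M" and T: "bounded_op_on M T" and C: "conjugation_on M C"
  shows "C_symmetric_on M C T \<longleftrightarrow> (\<forall>x\<in>M. \<forall>y\<in>M. cinner (T x) (C y) = cinner (T y) (C x))"
proof -
  have in_M: "C x \<in> M" "T x \<in> M" and CC: "C (C x) = x" if "x \<in> M" for x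
    using that C T by (auto simp: conjugation_on_def bounded_op_on_def)
  show ?thesis
  proof
    assume sym: "C_symmetric_on M C T"
    show "\<forall>x\<in>M. \<forall>y\<in>M. cinner (T x) (C y) = cinner (T y) (C x)"
    proof (intro ballI)
      fix x y assume xy: "x \<in> M" "y \<in> M"
      have "C (T y) = adjoint_on M T (C y)"
        using sym xy CC[OF adjoint_on_in[OF M T]] by (simp add: C_symmetric_on_def)
      then have "cinner (T x) (C y) = cinner x (C (T y))"
        using cinner_adjoint_on[OF M T] xy by simp
      also have "\<dots> = cinner (T y) (C x)"
        using cinner_conjugation_swap[OF C] xy in_M by blast
      finally show "cinner (T x) (C y) = cinner (T y) (C x)" .
    qed
  next
    assume sym: "\<forall>x\<in>M. \<forall>y\<in>M. cinner (T x) (C y) = cinner (T y) (C x)"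
    have "T y = C (adjoint_on M T (C y))" if y: "y \<in> M" for y
    proof -
      have "cinner (T x) (C y) = cinner x (C (T y))" if "x \<in> M" for x
        using sym y that cinner_conjugation_swap[OF C] in_M by metis
      then have "adjoint_on M T (C y) = C (T y)"
        using in_M y by (intro adjoint_on_eqI[OF M]) auto
      then show ?thesis
        using CC in_M y by simp
    qed
    then show "C_symmetric_on M C T"
      using T by (simp add: C_symmetric_on_def)
  qed
qed

section \<open>Extending partial conjugations\<close>

text \<open>A prescription of values \<open>C x = y\<close>, for \<open>(x, y) \<in> G\<close>, that does not conflict with \<open>C\<close> being
  an isometric involution. No linear structure is imposed on \<open>G\<close>: a maximal \<open>G\<close> acquires it, which
  keeps the adjunction of single pairs simple.\<close>

definition conj_rel :: "('a::complex_inner \<times> 'a) set \<Rightarrow> bool"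
  where "conj_rel G \<longleftrightarrow> sym G \<and>
    (\<forall>x x' y y'. (x, x') \<in> G \<longrightarrow> (y, y') \<in> G \<longrightarrow> cinner x' y' = cinner y x)"

lemma conj_rel_norm_diff:
  assumes "conj_rel G" "(x, x') \<in> G" "(y, y') \<in> G"
  shows "norm (x' - y') = norm (x - y)"
proof -
  have "cinner (x' - y') (x' - y') = cinner (x - y) (x - y)"
    using assms by (simp add: conj_rel_def cinner_diff_left cinner_diff_right)
  then show ?thesis
    by (simp add: cinner_self_eq_iff)
qed

text \<open>The relations between \<open>(p, p')\<close> and its mirror image \<open>(p', p)\<close> hold trivially, and those of
  \<open>(p', p)\<close> to \<open>G\<close> follow from the symmetry of \<open>G\<close>.\<close>

lemma conj_rel_insert:
  assumes G: "conj_rel G" and norm: "norm p' = norm p"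
    and p: "\<And>q q'. (q, q') \<in> G \<Longrightarrow> cinner p' q' = cinner q p"
  shows "conj_rel (insert (p, p') (insert (p', p) G))"
proof -
  have pp: "cinner p' p' = cinner p p"
    using norm by (simp add: cinner_self_eq_iff)
  have G': "(q', q) \<in> G" if "(q, q') \<in> G" for q q'
    using G that by (auto simp: conj_rel_def dest: symD)
  have p2: "cinner q' p' = cinner p q" "cinner p q' = cinner q p'" "cinner q' p = cinner p' q"
    if "(q, q') \<in> G" for q q'
    using p[OF that] p[OF G'[OF that]] by (auto intro: cinner_eq_commute)
  have "sym (insert (p, p') (insert (p', p) G))"
    using G' by (auto simp: sym_def)
  then show ?thesis
    using G pp p p2 unfolding conj_rel_def by auto
qed

lemma conj_rel_maximal:
  assumes "conj_rel G"
  obtains H where "G \<subseteq> H" "conj_rel H"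
    "\<And>p p'. norm p' = norm p \<Longrightarrow> (\<And>q q'. (q, q') \<in> H \<Longrightarrow> cinner p' q' = cinner q p) \<Longrightarrow> (p, p') \<in> H"
proof -
  let ?S = "{H. G \<subseteq> H \<and> conj_rel H}"
  have "\<exists>H\<in>?S. \<forall>X\<in>?S. H \<subseteq> X \<longrightarrow> X = H"
  proof (rule subset_Zorn_nonempty)
    show "?S \<noteq> {}" using assms by blast
    fix \<C> assume ne: "\<C> \<noteq> {}" and ch: "subset.chain ?S \<C>"
    then have in_S: "H \<in> \<C> \<Longrightarrow> G \<subseteq> H \<and> conj_rel H" for H
      by (auto simp: subset_chain_def)
    have "sym (\<Union>\<C>)"
      using in_S by (intro symI) (metis UnionE UnionI conj_rel_def symD)
    moreover have "cinner x' y' = cinner y x" if xy: "(x, x') \<in> \<Union>\<C>" "(y, y') \<in> \<Union>\<C>" for x x' y y'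
    proof -
      obtain X Y where X: "X \<in> \<C>" "(x, x') \<in> X" and Y: "Y \<in> \<C>" "(y, y') \<in> Y"
        using xy by blast
      have "X \<subseteq> Y \<or> Y \<subseteq> X"
        using ch X Y by (auto simp: subset_chain_def)
      then obtain Z where "Z \<in> \<C>" "(x, x') \<in> Z" "(y, y') \<in> Z"
        using X Y by blast
      then show ?thesis
        using in_S unfolding conj_rel_def by blast
    qed
    ultimately have "conj_rel (\<Union>\<C>)"
      by (auto simp: conj_rel_def)
    then show "\<Union>\<C> \<in> ?S"
      using ne in_S by auto
  qed
  then obtain H where H: "G \<subseteq> H" "conj_rel H" and
    max: "\<And>X. G \<subseteq> X \<Longrightarrow> conj_rel X \<Longrightarrow> H \<subseteq> X \<Longrightarrow> X = H"
    by auto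
  have "(p, p') \<in> H" if "norm p' = norm p" "\<And>q q'. (q, q') \<in> H \<Longrightarrow> cinner p' q' = cinner q p" for p p'
    using max[OF _ conj_rel_insert[OF H(2) that]] H(1) by blast
  then show thesis
    using that H by blast
qed

text \<open>A maximal prescription is a conjugation on its domain. The domain is a closed subspace, since
  sums, multiples and limits of pairs may be adjoined, and nothing but zero is orthogonal to it,
  since a vector \<open>e\<close> orthogonal to it may be adjoined as the pair \<open>(e, e)\<close>.\<close>

theorem conj_rel_extends:
  fixes G :: "('a::complex_hilbert_space \<times> 'a) set"
  assumes "conj_rel G"
  obtains C where "conjugation_on UNIV C" "\<And>x y. (x, y) \<in> G \<Longrightarrow> C x = y"
proof -
  obtain H where GH: "G \<subseteq> H" and H: "conj_rel H" and
    max: "\<And>p p'. norm p' = norm p \<Longrightarrow> (\<And>q q'. (q, q') \<in> H \<Longrightarrow> cinner p' q' = cinner q p) \<Longrightarrow> (p, p') \<in> H"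
    using conj_rel_maximal[OF assms] by blast
  have iso: "cinner x' y' = cinner y x" if "(x, x') \<in> H" "(y, y') \<in> H" for x x' y y'
    using H that by (auto simp: conj_rel_def)
  have sym: "(x', x) \<in> H" if "(x, x') \<in> H" for x x'
    using H that by (auto simp: conj_rel_def dest: symD)
  have add: "(x + y, x' + y') \<in> H" if xy: "(x, x') \<in> H" "(y, y') \<in> H" for x x' y y'
  proof (rule max)
    have "cinner (x' + y') (x' + y') = cinner (x + y) (x + y)"
      using iso xy by (simp add: cinner_add_left cinner_add_right)
    then show "norm (x' + y') = norm (x + y)"
      by (simp add: cinner_self_eq_iff)
  qed (use iso xy in \<open>simp add: cinner_add_left cinner_add_right\<close>)
  have scale: "(a *\<^sub>C x, cnj a *\<^sub>C x') \<in> H" if x: "(x, x') \<in> H" for a x x'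
  proof (rule max)
    have "cinner (cnj a *\<^sub>C x') (cnj a *\<^sub>C x') = cinner (a *\<^sub>C x) (a *\<^sub>C x)"
      using iso x by (simp add: cinner_scaleC_left cinner_scaleC_right)
    then show "norm (cnj a *\<^sub>C x') = norm (a *\<^sub>C x)"
      by (simp add: cinner_self_eq_iff)
  qed (use iso x in \<open>simp add: cinner_scaleC_left cinner_scaleC_right\<close>)
  have unique: "x' = y'" if "(x, x') \<in> H" "(x, y') \<in> H" for x x' y'
    using conj_rel_norm_diff[OF H that] by simp
  have closed: "closed (Domain H)"
  proof (rule closed_sequential_limits[THEN iffD2, rule_format])
    fix x l assume x: "(\<forall>n. x n \<in> Domain H) \<and> x \<longlonglongrightarrow> l"
    then have "\<forall>n. \<exists>y. (x n, y) \<in> H"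
      by (simp add: Domain_iff)
    then obtain x' where x': "\<And>n. (x n, x' n) \<in> H"
      by metis
    have "Cauchy x"
      using x LIMSEQ_imp_Cauchy by blast
    then have "Cauchy x'"
      unfolding Cauchy_def dist_norm using conj_rel_norm_diff[OF H x' x'] by simp
    then obtain l' where l': "x' \<longlonglongrightarrow> l'"
      using Cauchy_convergent convergent_def by blast
    have "(l, l') \<in> H"
    proof (rule max)
      have "norm (x' n) = norm (x n)" for n
        using iso[OF x'[of n] x'[of n]] by (simp add: cinner_self_eq_iff)
      moreover have "(\<lambda>n. norm (x n)) \<longlonglongrightarrow> norm l" "(\<lambda>n. norm (x' n)) \<longlonglongrightarrow> norm l'"
        using x l' by (auto intro: tendsto_norm)
      ultimately show "norm l' = norm l"
        using LIMSEQ_unique by simp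
    next
      fix q q' assume q: "(q, q') \<in> H"
      have "(\<lambda>n. cinner (x' n) q') \<longlonglongrightarrow> cinner l' q'" "(\<lambda>n. cinner q (x n)) \<longlonglongrightarrow> cinner q l"
        using x l' by (auto intro!: tendsto_intros)
      then show "cinner l' q' = cinner q l"
        using LIMSEQ_unique iso[OF x' q] by simp
    qed
    then show "l \<in> Domain H" by blast
  qed
  have dom: "closed_subspace (Domain H)"
    unfolding closed_subspace_def
    using closed add scale max[of 0 0] by (fastforce simp: Domain_iff)
  have total: "x \<in> Domain H" for x
  proof -
    obtain p where p: "p \<in> Domain H" and orth: "x - p \<in> orthogonal_complement (Domain H)"
      using orthogonal_decomposition[OF dom] by blast
    have "(x - p, x - p) \<in> H"
    proof (rule max)
      fix q q' assume "(q, q') \<in> H"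
      then have "cinner (x - p) q' = 0" "cinner (x - p) q = 0"
        using orth sym by (auto simp: orthogonal_complement_def)
      then show "cinner (x - p) q' = cinner q (x - p)"
        using cinner_eq_0_commute by fastforce
    qed simp
    then have "cinner (x - p) (x - p) = 0"
      using orth unfolding orthogonal_complement_def by blast
    then show ?thesis
      using p by simp
  qed
  then obtain C where C: "\<And>x. (x, C x) \<in> H"
    unfolding Domain_iff by metis
  have "C (x + y) = C x + C y" "C (a *\<^sub>C x) = cnj a *\<^sub>C C x" "C (C x) = x" for x y a
    using unique[OF C add[OF C C]] unique[OF C scale[OF C]] unique[OF C sym[OF C]] by auto
  then have "conjugation_on UNIV C"
    using iso C by (auto simp: conjugation_on_def)
  then show thesis
    using that unique C GH by blast
qed

section \<open>Partial isometries\<close>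

text \<open>Polarization: the real part of the inner product is determined by norms, and the imaginary
  part of \<open>\<langle>x, y\<rangle>\<close> is the real part of \<open>\<langle>x, \<i> y\<rangle>\<close>.\<close>

lemma partial_isometry_cinner:
  fixes T :: "'a::complex_inner \<Rightarrow> 'a"
  assumes T: "partial_isometry T" and xy: "x \<in> initial_space T" "y \<in> initial_space T"
  shows "cinner (T x) (T y) = cinner x y"
proof -
  have lin: "T (u + v) = T u + T v" "T (a *\<^sub>C u) = a *\<^sub>C T u" for u v a
    using T by (auto simp: partial_isometry_def bounded_op_on_def)
  have S: "closed_subspace (initial_space T)"
    by (simp add: initial_space_def closed_subspace_orthogonal_complement)
  have re: "Re (cinner (T u) (T v)) = Re (cinner u v)"
    if "u \<in> initial_space T" "v \<in> initial_space T" for u v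
  proof -
    have "u + v \<in> initial_space T"
      using S that by (simp add: closed_subspace_def)
    then have "norm (T u + T v) = norm (u + v)" "norm (T u) = norm u" "norm (T v) = norm v"
      using T that by (auto simp: partial_isometry_def simp flip: lin)
    then show ?thesis
      using norm_add_square[of u v] norm_add_square[of "T u" "T v"] by simp
  qed
  have "\<i> *\<^sub>C y \<in> initial_space T"
    using S xy by (simp add: closed_subspace_def)
  then have "Im (cinner (T x) (T y)) = Im (cinner x y)"
    using re[OF xy(1), of "\<i> *\<^sub>C y"] by (simp add: lin cinner_scaleC_right)
  then show ?thesis
    using re[OF xy] by (simp add: complex_eq_iff)
qed

lemma closed_subspace_kernel:
  assumes "bounded_op_on UNIV T"
  shows "closed_subspace (kernel T)"
proof -
  obtain K where "\<And>x. norm (T x) \<le> K * norm x"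
    using assms unfolding bounded_op_on_def by blast
  then show ?thesis
    using closed_subspace_functional_kernel[OF closed_subspace_UNIV, of T K] assms
    by (simp add: kernel_def bounded_op_on_def)
qed

lemma bounded_op_on_compression:
  fixes T :: "'a::complex_hilbert_space \<Rightarrow> 'a"
  assumes M: "closed_subspace M" and T: "bounded_op_on UNIV T"
    and A: "\<And>x. x \<in> M \<Longrightarrow> A x = orth_proj M (T x)"
  shows "bounded_op_on M A"
proof -
  have A_in: "A x \<in> M" if "x \<in> M" for x
    using A[OF that] orth_proj_in[OF M] by simp
  have A_inner: "cinner (A x) y = cinner (T x) y" if "x \<in> M" "y \<in> M" for x y
    using A that cinner_orth_proj[OF M] by simp
  have M': "x + y \<in> M" "a *\<^sub>C x \<in> M" if "x \<in> M" "y \<in> M" for x y a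
    using M that by (auto simp: closed_subspace_def)
  have add: "A (x + y) = A x + A y" if "x \<in> M" "y \<in> M" for x y
    using T that by (intro cinner_ext_on[OF M])
      (auto simp: A_in A_inner M' cinner_add_left bounded_op_on_def)
  have scale: "A (a *\<^sub>C x) = a *\<^sub>C A x" if "x \<in> M" for a x
    using T that by (intro cinner_ext_on[OF M])
      (auto simp: A_in A_inner M' cinner_scaleC_left bounded_op_on_def)
  obtain K where K: "\<And>x. norm (T x) \<le> K * norm x"
    using T unfolding bounded_op_on_def by blast
  have "norm (A x) \<le> K * norm x" if x: "x \<in> M" for x
  proof -
    have "cinner (A x) (A x) = cinner (T x) (A x)"
      by (rule A_inner[OF x A_in[OF x]])
    then have "(norm (A x))\<^sup>2 = cmod (cinner (T x) (A x))"
      using cinner_self[of "A x"] by (metis norm_of_real abs_of_nonneg zero_le_power2)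
    then have "norm (A x) * norm (A x) \<le> norm (T x) * norm (A x)"
      using cauchy_schwarz[of "T x" "A x"] by (simp add: power2_eq_square)
    then have "norm (A x) \<le> norm (T x)"
      by (cases "A x = 0") auto
    then show ?thesis
      using K[of x] by linarith
  qed
  then show ?thesis
    using A_in add scale by (auto simp: bounded_op_on_def)
qed

theorem theorem2:
  fixes T A :: "'a::complex_hilbert_space \<Rightarrow> 'a" and H1 :: "'a set"
  assumes separable: "separable_space (euclidean :: 'a topology)"
    and T_bounded: "bounded_op_on UNIV T"
    and T_partial_isometry: "partial_isometry T"
    and H1: "H1 = initial_space T"
    and A: "\<And>x. x \<in> H1 \<Longrightarrow> A x = orth_proj H1 (T x)"
  shows "complex_symmetric_on UNIV T \<longleftrightarrow> complex_symmetric_on H1 A"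
proof -
  have M: "closed_subspace H1"
    by (simp add: H1 initial_space_def closed_subspace_orthogonal_complement)
  have A_bounded: "bounded_op_on H1 A"
    by (rule bounded_op_on_compression[OF M T_bounded A])
  have A_inner: "cinner (A x) y = cinner (T x) y" if "x \<in> H1" "y \<in> H1" for x y
    using A that cinner_orth_proj[OF M] by simp
  have T_iso: "cinner (T x) (T y) = cinner x y" if "x \<in> H1" "y \<in> H1" for x y
    using partial_isometry_cinner[OF T_partial_isometry] that by (simp add: H1)
  have T_add: "T (x + y) = T x + T y" and T_scale: "T (a *\<^sub>C x) = a *\<^sub>C T x" for x y a
    using T_bounded by (auto simp: bounded_op_on_def)
  note T_sym_iff = C_symmetric_on_iff[OF closed_subspace_UNIV T_bounded]
  note A_sym_iff = C_symmetric_on_iff[OF M A_bounded]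
  show ?thesis
  proof
    assume "complex_symmetric_on UNIV T"
    then obtain C where C: "conjugation_on UNIV C" and "C_symmetric_on UNIV C T"
      by (auto simp: complex_symmetric_on_def)
    then have T_sym: "cinner (T x) (C y) = cinner (T y) (C x)" for x y
      using T_sym_iff by blast
    have C_props: "C (x + y) = C x + C y" "C (a *\<^sub>C x) = cnj a *\<^sub>C C x" "C (C x) = x"
      "cinner (C x) (C y) = cinner y x" for x y a
      using C by (auto simp: conjugation_on_def)
    have C_swap: "cinner x (C y) = cinner y (C x)" for x y
      using cinner_conjugation_swap[OF C] by simp
    define J where "J x = C (T x)" for x
    have J_in: "J x \<in> H1" for x
    proof -
      have "cinner k (J x) = 0" if "k \<in> kernel T" for k
        using C_swap[of k "T x"] T_sym[of x k] that by (simp add: J_def kernel_def)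
      then have "cinner (J x) k = 0" if "k \<in> kernel T" for k
        using that cinner_eq_0_commute by blast
      then show ?thesis
        by (auto simp: H1 initial_space_def orthogonal_complement_def)
    qed
    have JJ: "J (J x) = x" if x: "x \<in> H1" for x
    proof (rule cinner_ext_on[OF M J_in x])
      fix y assume y: "y \<in> H1"
      have "cinner y (J (J x)) = cinner (T y) (C (J x))"
        using C_swap[of y "T (J x)"] T_sym[of "J x" y] by (simp add: J_def)
      also have "\<dots> = cinner y x"
        using T_iso x y by (simp add: J_def C_props)
      finally show "cinner (J (J x)) y = cinner x y"
        by (rule cinner_eq_commute)
    qed
    have J: "conjugation_on H1 J"
      using J_in JJ T_iso by (auto simp: conjugation_on_def)
        (simp_all add: J_def T_add T_scale C_props T_iso)
    have "cinner (A x) (J y) = cinner (A y) (J x)" if "x \<in> H1" "y \<in> H1" for x y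
      using C_swap[of "T x" "T y"] that by (simp add: A_inner J_in) (simp add: J_def)
    then have "C_symmetric_on H1 J A"
      using A_sym_iff[OF J] by blast
    with J show "complex_symmetric_on H1 A"
      by (auto simp: complex_symmetric_on_def)
  next
    assume "complex_symmetric_on H1 A"
    then obtain J where J: "conjugation_on H1 J" and "C_symmetric_on H1 J A"
      by (auto simp: complex_symmetric_on_def)
    then have A_sym: "cinner (A x) (J y) = cinner (A y) (J x)" if "x \<in> H1" "y \<in> H1" for x y
      using A_sym_iff that by blast
    have J_in: "J x \<in> H1" if "x \<in> H1" for x
      using J that by (auto simp: conjugation_on_def)
    have J_iso: "cinner (J x) (J y) = cinner y x" if "x \<in> H1" "y \<in> H1" for x y
      using J that by (auto simp: conjugation_on_def)
    have TJ: "cinner (T x) (J y) = cinner (T y) (J x)" if "x \<in> H1" "y \<in> H1" for x y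
      using A_sym A_inner J_in that by metis
    have JT: "cinner (J x) (T y) = cinner (J y) (T x)" if "x \<in> H1" "y \<in> H1" for x y
      using cinner_eq_commute[OF TJ[OF that]] by simp
    let ?G = "(\<lambda>x. (T x, J x)) ` H1 \<union> (\<lambda>x. (J x, T x)) ` H1"
    have "conj_rel ?G"
      unfolding conj_rel_def sym_def using J_iso T_iso TJ JT by auto
    then obtain C where C: "conjugation_on UNIV C" and "\<And>x y. (x, y) \<in> ?G \<Longrightarrow> C x = y"
      by (rule conj_rel_extends) (rule that)
    then have CT: "C (T x) = J x" if "x \<in> H1" for x
      using that by blast
    have C_swap: "cinner x (C y) = cinner y (C x)" for x y
      using cinner_conjugation_swap[OF C] by simp
    have comp: "\<exists>x1\<in>H1. T x = T x1 \<and> (\<forall>z\<in>H1. cinner x z = cinner x1 z)" for x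
    proof -
      obtain k where k: "k \<in> kernel T" and x1: "x - k \<in> H1"
        unfolding H1 initial_space_def
        using orthogonal_decomposition[OF closed_subspace_kernel[OF T_bounded]] by blast
      have "T x = T (x - k)"
        using T_add[of "x - k" k] k by (simp add: kernel_def)
      moreover have "cinner x z = cinner (x - k) z" if "z \<in> H1" for z
      proof -
        have "cinner z k = 0"
          using that k by (auto simp: H1 initial_space_def orthogonal_complement_def)
        then show ?thesis
          by (simp add: cinner_diff_left cinner_eq_0_commute)
      qed
      ultimately show ?thesis
        using x1 by blast
    qed
    have "cinner (T x) (C y) = cinner (T y) (C x)" for x y
    proof -
      obtain x1 y1 where x1: "x1 \<in> H1" "T x = T x1" "\<forall>z\<in>H1. cinner x z = cinner x1 z"
        and y1: "y1 \<in> H1" "T y = T y1" "\<forall>z\<in>H1. cinner y z = cinner y1 z"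
        using comp by meson
      have "cinner (T x) (C y) = cinner y (J x1)"
        using C_swap[of "T x" y] CT x1 by simp
      also have "\<dots> = cinner x1 (J y1)"
        using y1 J_in x1 cinner_conjugation_swap[OF J] by simp
      also have "\<dots> = cinner (T y) (C x)"
        using C_swap[of "T y" x] CT y1 x1 J_in by simp
      finally show ?thesis .
    qed
    then have "C_symmetric_on UNIV C T"
      using T_sym_iff[OF C] by blast
    with C show "complex_symmetric_on UNIV T"
      by (auto simp: complex_symmetric_on_def)
  qed
qed

end
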